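(* Let $(S,\cdot)$ be a commutative semigroup, let $B$ be a complex Banach space, let $g:S\to\mathbb{C}$ and $\psi:S^2\to[0,\infty)$ be functions, and suppose $N_{g,\psi}\neq\emptyset$. Then for every function $f:S\to B$ satisfying $$\|f(x\cdot y)-g(x)f(y)\|\le\psi(x,y)\quad\text{for all }x,y\in S,$$ there exists a unique function $T:S\to B$ such that $$T(x\cdot y)=g(x)T(y)\quad\text{for all }x,y\in S$$ and $$\|f(y)-T(y)\|\le\inf_{a\in N_{g,\psi}}\frac{\psi(a,y)}{|g(a)|-1}\quad\text{for all }y\in S.$$ Moreover, this $T$ satisfies $(g(x\cdot y)-g(x)g(y))\,T(z)=0$ for all $x,y,z\in S$.
   Context: For a semigroup $(S,\cdot)$ and functions $g:S\to\mathbb{C}$, $\psi:S^2\to[0,\infty)$, the set $N_{g,\psi}$ consists of all $a\in S$ such that $|g(a)|>1$ and $\psi(x,y\cdot a)\le\psi(x,y)$ for all $x,y\in S$. *)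

theory Defs
  imports Complex_Main
begin

(* The distribution only has real Banach spaces (class banach). A complex Banach space is a real
   one with a complex scalar multiplication that extends the real one and for which the norm is
   absolutely homogeneous. *)
class complex_normed_vector = real_normed_vector +
  fixes scaleC :: "complex \<Rightarrow> 'a \<Rightarrow> 'a"  (infixr "*\<^sub>C" 75)
  assumes scaleC_add_right: "c *\<^sub>C (x + y) = c *\<^sub>C x + c *\<^sub>C y"
    and scaleC_add_left: "(c + d) *\<^sub>C x = c *\<^sub>C x + d *\<^sub>C x"
    and scaleC_scaleC: "c *\<^sub>C d *\<^sub>C x = (c * d) *\<^sub>C x"
    and scaleC_of_real: "complex_of_real r *\<^sub>C x = r *\<^sub>R x"
    and norm_scaleC: "norm (c *\<^sub>C x) = cmod c * norm x"

class complex_banach = complex_normed_vector + banach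

instantiation complex :: complex_banach
begin

definition scaleC_complex :: "complex \<Rightarrow> complex \<Rightarrow> complex"
  where "scaleC_complex c x = c * x"

instance
  by standard (simp_all add: scaleC_complex_def algebra_simps norm_mult scaleR_conv_of_real)

end

definition N_set :: "('a::semigroup_mult \<Rightarrow> complex) \<Rightarrow> ('a \<Rightarrow> 'a \<Rightarrow> real) \<Rightarrow> 'a set"
  where "N_set g \<psi> = {a. cmod (g a) > 1 \<and> (\<forall>x y. \<psi> x (y * a) \<le> \<psi> x y)}"

end

theory Submission imports Defs begin

text \<open>
  For \<open>a \<in> N\<close>, the sequence \<open>f (y a\<^sup>n) / g(a)\<^sup>n\<close> has increments of norm at most
  \<open>\<psi>(a, y) / |g(a)|\<^sup>n\<^sup>+\<^sup>1\<close>, because \<open>\<psi>(a, y a\<^sup>n) \<le> \<psi>(a, y)\<close>; its limit \<open>T y\<close> satisfies the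
  functional equation, since the defect of \<open>f\<close> at \<open>(x, y a\<^sup>n)\<close> stays bounded while it is divided
  by \<open>g(a)\<^sup>n\<close>. If two solutions of the equation differ by at most \<open>K(y)\<close> with
  \<open>K(y a) \<le> K(y)\<close>, then their difference at \<open>y a\<^sup>n\<close> is \<open>g(a)\<^sup>n\<close> times the one at \<open>y\<close>, so it
  vanishes. Hence \<open>T\<close> does not depend on \<open>a\<close>, which gives the bound by the infimum as well as
  uniqueness.
\<close>

text \<open>Real scalars act as complex ones, so they commute with \<open>c\<close>. Linearity
  yields the difference rule below; boundedness lets limits pass through
  \<open>scaleC\<close>.\<close>

lemma bounded_linear_scaleC: "bounded_linear (\<lambda>x::'b::complex_normed_vector. c *\<^sub>C x)"
proof (rule bounded_linear_intro)
  show "c *\<^sub>C (r *\<^sub>R x) = r *\<^sub>R (c *\<^sub>C x)" for r and x :: 'b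
    by (metis scaleC_of_real scaleC_scaleC mult.commute)
  show "norm (c *\<^sub>C x) \<le> norm x * cmod c" for x :: 'b
    by (simp add: norm_scaleC)
qed (rule scaleC_add_right)

lemmas scaleC_diff_right = linear_diff[OF bounded_linear.linear[OF bounded_linear_scaleC]]

lemma scaleC_one [simp]: "1 *\<^sub>C (x::'b::complex_normed_vector) = x"
  using scaleC_of_real[of 1 x] by simp

lemma scaleC_diff_left: "(c - d) *\<^sub>C (x::'b::complex_normed_vector) = c *\<^sub>C x - d *\<^sub>C x"
  using scaleC_add_left[of "c - d" d x] by simp

text \<open>Comparison with a geometric series makes the telescoping series of increments absolutely
  convergent; the distance from \<open>u 0\<close> to the limit is the norm of its sum.\<close>

lemma geometric_increments_limit:
  fixes u :: "nat \<Rightarrow> 'b::banach"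
  assumes r: "0 \<le> r" "r < 1" and u: "\<And>n. norm (u (Suc n) - u n) \<le> c * r ^ n"
  obtains L where "u \<longlonglongrightarrow> L" "norm (u 0 - L) \<le> c / (1 - r)"
proof -
  have geo: "(\<lambda>n. c * r ^ n) sums (c / (1 - r))"
    using sums_mult[OF geometric_sums[of r], of c] r by simp
  have sm: "summable (\<lambda>n. norm (u (Suc n) - u n))"
    by (rule summable_comparison_test'[OF sums_summable[OF geo], of 0]) (use u in auto)
  let ?S = "\<Sum>n. u (Suc n) - u n"
  have "(\<lambda>n. \<Sum>i<n. u (Suc i) - u i) \<longlonglongrightarrow> ?S"
    using summable_norm_cancel[OF sm] by (rule summable_LIMSEQ)
  then have "(\<lambda>n. u 0 + (u n - u 0)) \<longlonglongrightarrow> u 0 + ?S"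
    unfolding sum_lessThan_telescope by (intro tendsto_intros)
  moreover have "norm ?S \<le> c / (1 - r)"
    using summable_norm[OF sm] suminf_le[OF u sm sums_summable[OF geo]] sums_unique[OF geo]
    by linarith
  ultimately show thesis by (intro that[of "u 0 + ?S"]) simp_all
qed

text \<open>A semigroup has no \<open>a\<^sup>0\<close>, so \<open>y a\<^sup>n\<close> is the \<open>n\<close>-fold iterate of right multiplication.\<close>

definition rpow :: "'a::semigroup_mult \<Rightarrow> nat \<Rightarrow> 'a \<Rightarrow> 'a"
  where "rpow a n = (\<lambda>y. y * a) ^^ n"

lemma rpow_0 [simp]: "rpow a 0 y = y"
  and rpow_Suc [simp]: "rpow a (Suc n) y = rpow a n y * a"
  by (simp_all add: rpow_def)

lemma mult_rpow: "x * rpow a n y = rpow a n (x * y)"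
  by (induction n) (simp_all flip: mult.assoc)

lemma rpow_decreasing:
  fixes K :: "'a::semigroup_mult \<Rightarrow> real"
  assumes "\<And>y. K (y * a) \<le> K y"
  shows "K (rpow a n y) \<le> K y"
  by (induction n) (auto intro: order_trans[OF assms])

lemma equivariant_unique:
  fixes T T' :: "'a::ab_semigroup_mult \<Rightarrow> 'b::complex_normed_vector"
  assumes T: "\<And>x y. T (x * y) = g x *\<^sub>C T y" and T': "\<And>x y. T' (x * y) = g x *\<^sub>C T' y"
    and K: "\<And>y. norm (T y - T' y) \<le> K y" and K_decr: "\<And>y. K (y * a) \<le> K y"
    and a: "cmod (g a) > 1"
  shows "T = T'"
proof
  fix y
  have eq: "norm (T (rpow a n y) - T' (rpow a n y)) = cmod (g a) ^ n * norm (T y - T' y)" for n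
  proof (induction n)
    case (Suc n)
    have "T (rpow a (Suc n) y) - T' (rpow a (Suc n) y)
        = g a *\<^sub>C (T (rpow a n y) - T' (rpow a n y))"
      by (simp add: scaleC_diff_right mult.commute[of _ a] T T')
    with Suc show ?case by (simp add: norm_scaleC)
  qed simp
  \<comment> \<open>The left side is the difference of \<open>T\<close> and \<open>T'\<close> at
    \<open>rpow a n y\<close>, where \<open>K\<close> is still at most \<open>K y\<close>. The bound
    is thus independent of \<open>n\<close>, while the powers of \<open>cmod (g a)\<close> are
    unbounded.\<close>
  have bound: "cmod (g a) ^ n * norm (T y - T' y) \<le> K y" for n
    using K[of "rpow a n y"] rpow_decreasing[of K a n y] K_decr unfolding eq by fastforce
  show "T y = T' y"
  proof (rule ccontr)
    assume "T y \<noteq> T' y"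
    then have pos: "norm (T y - T' y) > 0" by simp
    obtain n where "K y / norm (T y - T' y) < cmod (g a) ^ n"
      using real_arch_pow[OF a] by blast
    with bound[of n] pos show False by (simp add: divide_less_eq)
  qed
qed

lemma equivariant_approx_exists:
  fixes f :: "'a::ab_semigroup_mult \<Rightarrow> 'b::complex_banach"
  assumes f: "\<And>x y. norm (f (x * y) - g x *\<^sub>C f y) \<le> \<psi> x y" and a: "a \<in> N_set g \<psi>"
  obtains T where "\<And>x y. T (x * y) = g x *\<^sub>C T y"
    and "\<And>y. norm (f y - T y) \<le> \<psi> a y / (cmod (g a) - 1)"
proof -
  define r where "r = 1 / cmod (g a)"
  have ga: "cmod (g a) > 1" and decr: "\<And>x y. \<psi> x (y * a) \<le> \<psi> x y"
    using a by (auto simp: N_set_def)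
  have r: "0 \<le> r" "r < 1" using ga by (auto simp: r_def divide_simps)
  have \<psi>_rpow: "\<psi> x (rpow a n y) \<le> \<psi> x y" for x y n
    using rpow_decreasing[of "\<psi> x"] decr by blast
  define u where "u y n = inverse (g a) ^ n *\<^sub>C f (rpow a n y)" for y n
  \<comment> \<open>Commutativity turns \<open>rpow a n y * a\<close> into
    \<open>a * rpow a n y\<close>, so the increment is a scaled defect of \<open>f\<close> with
    first argument \<open>a\<close>. The extra factor \<open>r\<close> makes the geometric bound
    \<open>r * \<psi> a y / (1 - r)\<close> equal to the required one.\<close>
  have "norm (u y (Suc n) - u y n) \<le> r * \<psi> a y * r ^ n" for y n
  proof -
    have "g a \<noteq> 0" using ga by auto
    then have "inverse (g a) ^ Suc n * g a = inverse (g a) ^ n" by (simp add: mult_ac)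
    then have "u y (Suc n) - u y n
        = inverse (g a) ^ Suc n *\<^sub>C (f (a * rpow a n y) - g a *\<^sub>C f (rpow a n y))"
      by (simp only: u_def rpow_Suc scaleC_diff_right scaleC_scaleC mult.commute[of _ a])
    then have "norm (u y (Suc n) - u y n)
        = r ^ Suc n * norm (f (a * rpow a n y) - g a *\<^sub>C f (rpow a n y))"
      by (simp only: norm_scaleC norm_power norm_divide norm_one r_def inverse_eq_divide)
    also have "\<dots> \<le> r ^ Suc n * \<psi> a y"
      using order_trans[OF f \<psi>_rpow] r by (intro mult_left_mono) auto
    finally show ?thesis by (simp add: mult_ac)
  qed
  then have "\<exists>L. u y \<longlonglongrightarrow> L \<and> norm (u y 0 - L) \<le> r * \<psi> a y / (1 - r)" for y
    using geometric_increments_limit[OF r, of "u y"] by blast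
  then obtain T where T: "\<And>y. u y \<longlonglongrightarrow> T y"
    and bound: "\<And>y. norm (u y 0 - T y) \<le> r * \<psi> a y / (1 - r)"
    by metis
  show thesis
  proof
    show "norm (f y - T y) \<le> \<psi> a y / (cmod (g a) - 1)" for y
    proof -
      have "r * \<psi> a y / (1 - r) = \<psi> a y / (cmod (g a) - 1)"
        using ga by (auto simp: r_def divide_simps)
      with bound[of y] show ?thesis by (simp add: u_def)
    qed
    show "T (x * y) = g x *\<^sub>C T y" for x y
    proof -
      \<comment> \<open>By associativity \<open>rpow a n (x * y)\<close> is
        \<open>x * rpow a n y\<close>, so this difference is again a scaled defect of
        \<open>f\<close>, now with first argument \<open>x\<close>.\<close>
      have "norm (u (x * y) n - g x *\<^sub>C u y n) \<le> r ^ n * \<psi> x y" for n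
      proof -
        have "u (x * y) n - g x *\<^sub>C u y n
            = inverse (g a) ^ n *\<^sub>C (f (x * rpow a n y) - g x *\<^sub>C f (rpow a n y))"
          by (simp add: u_def mult_rpow scaleC_diff_right scaleC_scaleC mult.commute)
        then have "norm (u (x * y) n - g x *\<^sub>C u y n)
            = r ^ n * norm (f (x * rpow a n y) - g x *\<^sub>C f (rpow a n y))"
          by (simp only: norm_scaleC norm_power norm_divide norm_one r_def inverse_eq_divide)
        also have "\<dots> \<le> r ^ n * \<psi> x y"
          using order_trans[OF f \<psi>_rpow] r by (intro mult_left_mono) auto
        finally show ?thesis .
      qed
      moreover have "(\<lambda>n. r ^ n * \<psi> x y) \<longlonglongrightarrow> 0"
        using r by (intro tendsto_mult_left_zero LIMSEQ_power_zero) auto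
      ultimately have "(\<lambda>n. u (x * y) n - g x *\<^sub>C u y n) \<longlonglongrightarrow> 0"
        by (elim tendsto_0_le[where K = 1])
          (simp add: always_eventually order_trans[OF _ abs_ge_self])
      moreover have "(\<lambda>n. u (x * y) n - g x *\<^sub>C u y n) \<longlonglongrightarrow> T (x * y) - g x *\<^sub>C T y"
        by (intro tendsto_diff bounded_linear.tendsto[OF bounded_linear_scaleC] T)
      ultimately show ?thesis using LIMSEQ_unique by fastforce
    qed
  qed
qed

theorem theorem2p3:
  fixes g :: "'a::ab_semigroup_mult \<Rightarrow> complex"
    and \<psi> :: "'a \<Rightarrow> 'a \<Rightarrow> real"
    and f :: "'a \<Rightarrow> 'b::complex_banach"
  assumes psi_nonneg: "\<And>x y. 0 \<le> \<psi> x y"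
    and N_nonempty: "N_set g \<psi> \<noteq> {}"
    and f_approx: "\<And>x y. norm (f (x * y) - g x *\<^sub>C f y) \<le> \<psi> x y"
  shows "\<exists>T :: 'a \<Rightarrow> 'b.
    ((\<forall>x y. T (x * y) = g x *\<^sub>C T y) \<and>
     (\<forall>y. norm (f y - T y) \<le> (INF a\<in>N_set g \<psi>. \<psi> a y / (cmod (g a) - 1)))) \<and>
    (\<forall>T' :: 'a \<Rightarrow> 'b.
       (\<forall>x y. T' (x * y) = g x *\<^sub>C T' y) \<and>
       (\<forall>y. norm (f y - T' y) \<le> (INF a\<in>N_set g \<psi>. \<psi> a y / (cmod (g a) - 1)))
       \<longrightarrow> T' = T) \<and>
    (\<forall>x y z. (g (x * y) - g x * g y) *\<^sub>C T z = 0)"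
proof -
  let ?N = "N_set g \<psi>" and ?q = "\<lambda>a y. \<psi> a y / (cmod (g a) - 1)"
  let ?hom = "\<lambda>T :: 'a \<Rightarrow> 'b. \<forall>x y. T (x * y) = g x *\<^sub>C T y"
  have gN: "cmod (g a) > 1" and decr: "\<psi> x (y * a) \<le> \<psi> x y" if "a \<in> ?N" for a x y
    using that by (auto simp: N_set_def)
  \<comment> \<open>Allowing two indices serves two purposes: different ones show that the limit is
    independent of the index, equal ones give the final uniqueness.\<close>
  have unique: "T = T'"
    if "a \<in> ?N" "b \<in> ?N" "?hom T" "?hom T'"
      and "\<And>y. norm (f y - T y) \<le> ?q a y" "\<And>y. norm (f y - T' y) \<le> ?q b y" for a b T T'
  proof (rule equivariant_unique[where g = g and K = "\<lambda>y. ?q a y + ?q b y" and a = a])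
    show "norm (T y - T' y) \<le> ?q a y + ?q b y" for y
      using norm_triangle_ineq4[of "f y - T' y" "f y - T y"] that(5,6)[of y] by simp
    \<comment> \<open>Membership of \<open>a\<close> in \<open>?N\<close> controls
      \<open>\<psi> x\<close> for every first argument \<open>x\<close>, hence also the term with
      \<open>b\<close>.\<close>
    show "?q a (y * a) + ?q b (y * a) \<le> ?q a y + ?q b y" for y
      using that gN decr by (intro add_mono divide_right_mono) (auto simp: less_imp_le)
  qed (use that gN in auto)
  \<comment> \<open>A real infimum is a lower bound only for a family bounded below; here 0 is such
    a bound.\<close>
  have INF_lower: "(INF a\<in>?N. ?q a y) \<le> ?q a y" if "a \<in> ?N" for a y
    using that gN psi_nonneg
    by (intro cINF_lower bdd_belowI2[of _ 0] divide_nonneg_nonneg) (auto simp: less_imp_le)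
  obtain a where a: "a \<in> ?N" using N_nonempty by blast
  obtain T where T: "\<And>x y. T (x * y) = g x *\<^sub>C T y" and Ta: "\<And>y. norm (f y - T y) \<le> ?q a y"
    using equivariant_approx_exists[OF f_approx a] by blast
  have Tb: "norm (f y - T y) \<le> ?q b y" if b: "b \<in> ?N" for b y
  proof -
    obtain T' where T': "\<And>x y. T' (x * y) = g x *\<^sub>C T' y"
      and T'b: "\<And>y. norm (f y - T' y) \<le> ?q b y"
      using equivariant_approx_exists[OF f_approx b] by blast
    have "T = T'" using unique[of a b T T'] a b T T' Ta T'b by blast
    with T'b show ?thesis by blast
  qed
  have "norm (f y - T y) \<le> (INF a\<in>?N. ?q a y)" for y
    using N_nonempty Tb by (intro cINF_greatest) auto
  moreover have "T' = T"
    if "?hom T'" "\<forall>y. norm (f y - T' y) \<le> (INF a\<in>?N. ?q a y)" for T'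
    using unique[of a a T' T] a that T Ta order_trans[OF _ INF_lower[OF a]] by blast
  moreover have "(g (x * y) - g x * g y) *\<^sub>C T z = 0" for x y z
  proof -
    \<comment> \<open>Associativity lets \<open>T\<close> at the triple product be expanded in two
      ways: pulling out \<open>x * y\<close> at once, or \<open>x\<close> and then
      \<open>y\<close>.\<close>
    have "g (x * y) *\<^sub>C T z = T (x * (y * z))" by (simp flip: T add: mult.assoc)
    also have "\<dots> = (g x * g y) *\<^sub>C T z" by (simp add: T scaleC_scaleC)
    finally show ?thesis by (simp add: scaleC_diff_left)
  qed
  ultimately show ?thesis using T by (intro exI[of _ T]) blast
qed

end
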